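(* Let $(\mathbf{P}_2, Sc_{ij}, \mathbf{0}_2)$ be the Peano 2-system of natural 2-numbers, equipped with the addition $+$ and the multiplication $\cdot$ of natural 2-numbers. Then $\langle \mathbf{P}_2, +, \cdot, \mathbf{0}_2, 1_{00}\rangle$ is a commutative semiring, with additive identity $\mathbf{0}_2$ and multiplicative identity $1_{00}$.
   Context: Let $N_0=\{0,1,2,\ldots\}$. Natural 2-numbers are two-dimensional arrays $A_2=(\alpha_{ij})_{i,j\in N_0}$ with entries $\alpha_{ij}\in N_0$ (the entry $\alpha_{ij}$ is the multiplicity of the element indexed by $(i,j)$). Two arrays are equal iff all their entries are equal. The array with all entries $0$ is denoted $\mathbf{0}_2$. For $i,j\in N_0$, the multisuccessor function $Sc_{ij}$ sends an array to the array obtained by increasing its $(i,j)$ entry by $1$ and leaving all other entries unchanged. The Peano 2-system $(\mathbf{P}_2,Sc_{ij},\mathbf{0}_2)$ is a set $\mathbf{P}_2$ of such arrays, containing $\mathbf{0}_2$ and closed under all $Sc_{ij}$, such that: (I) $Sc_{pq}(A_2)\ne\mathbf{0}_2$ for all $p,q$ and all $A_2\in\mathbf{P}_2$; (II) every $A_2\in\mathbf{P}_2$ has a unique $ij$-successor $Sc_{ij}(A_2)$ for each $i,j$, while $Sc_{ij}(A_2)\neq Sc_{pq}(A_2)$ if $i\ne p$, $j\neq q$; (III) $Sc_{ij}(A_2)=Sc_{ij}(B_2)$ implies $A_2=B_2$; (IV) (induction) any subset of $\mathbf{P}_2$ that contains $\mathbf{0}_2$ and is closed under $Sc_{ij}$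 for all $i,j\in N_0$ is equal to $\mathbf{P}_2$. Elements of $\mathbf{P}_2$ are called natural 2-numbers. Put $1_{ij}=Sc_{ij}(\mathbf{0}_2)$. Addition of natural 2-numbers is the (unique) binary operation $+$ on $\mathbf{P}_2$ such that $A_2+1_{ij}=Sc_{ij}(A_2)$ and $A_2+Sc_{ij}(B_2)=Sc_{ij}(A_2+B_2)$ for all $A_2,B_2\in\mathbf{P}_2$ and all $i,j\in N_0$. For $A_2=(\alpha_{kl})$ and $i,j\in N_0$, the shift $(A_2)_{ij}$ is the array whose $(k,l)$ entry is $\alpha_{k-i,\,l-j}$ if $k\ge i$ and $l\ge j$, and $0$ otherwise. Multiplication of natural 2-numbers is the (unique) binary operation $\cdot$ on $\mathbf{P}_2$ such that $A_2\cdot 1_{ij}=(A_2)_{ij}$ and $A_2\cdot Sc_{ij}(B_2)=A_2\cdot B_2+(A_2)_{ij}$ for all $A_2,B_2\in\mathbf{P}_2$ and all $i,j\in N_0$. *)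

theory Defs
  imports "HOL-Algebra.Ring"
begin

type_synonym array2 = "nat \<Rightarrow> nat \<Rightarrow> nat"

definition zero2 :: array2 ("\<zero>\<^sub>2") where
  "\<zero>\<^sub>2 = (\<lambda>k l. 0)"

definition Sc :: "nat \<Rightarrow> nat \<Rightarrow> array2 \<Rightarrow> array2" where
  "Sc i j A = (\<lambda>k l. if k = i \<and> l = j then A k l + 1 else A k l)"

definition one2 :: "nat \<Rightarrow> nat \<Rightarrow> array2" where
  "one2 i j = Sc i j \<zero>\<^sub>2"

definition shift2 :: "array2 \<Rightarrow> nat \<Rightarrow> nat \<Rightarrow> array2" where
  "shift2 A i j = (\<lambda>k l. if k \<ge> i \<and> l \<ge> j then A (k - i) (l - j) else 0)"

text \<open>
  As \<open>Sc\<close> is a concrete function on arrays, the axioms on successors (in particular existence and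
  uniqueness of the successor) express properties of the carrier \<open>P\<close>. In \<open>Sc_neq\<close> the condition is
  that both indices differ; for these arrays the conclusion holds as soon as one of them does.
\<close>
locale peano_2_system =
  fixes P :: "array2 set"
  assumes zero_in: "\<zero>\<^sub>2 \<in> P"
    and Sc_in: "A \<in> P \<Longrightarrow> Sc i j A \<in> P"
    and Sc_neq_zero: "A \<in> P \<Longrightarrow> Sc p q A \<noteq> \<zero>\<^sub>2"
    and Sc_unique: "A \<in> P \<Longrightarrow> \<exists>!B. B \<in> P \<and> B = Sc i j A"
    and Sc_neq: "A \<in> P \<Longrightarrow> i \<noteq> p \<Longrightarrow> j \<noteq> q \<Longrightarrow> Sc i j A \<noteq> Sc p q A"
    and Sc_inject: "A \<in> P \<Longrightarrow> B \<in> P \<Longrightarrow> Sc i j A = Sc i j B \<Longrightarrow> A = B"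
    and induction_axiom:
      "S \<subseteq> P \<Longrightarrow> \<zero>\<^sub>2 \<in> S \<Longrightarrow> (\<forall>A\<in>S. \<forall>i j. Sc i j A \<in> S) \<Longrightarrow> S = P"

text \<open>
  Binary operations on \<open>P\<close> are extensional, i.e. \<open>undefined\<close> outside \<open>P\<close>, so that an operation that
  is unique on \<open>P\<close> is unique as a HOL function and can be named by a definite description.
\<close>
definition is_addition2 :: "array2 set \<Rightarrow> (array2 \<Rightarrow> array2 \<Rightarrow> array2) \<Rightarrow> bool" where
  "is_addition2 P f \<longleftrightarrow>
     f \<in> P \<rightarrow>\<^sub>E P \<rightarrow>\<^sub>E P \<and>
     (\<forall>A\<in>P. \<forall>i j. f A (one2 i j) = Sc i j A) \<and>
     (\<forall>A\<in>P. \<forall>B\<in>P. \<forall>i j. f A (Sc i j B) = Sc i j (f A B))"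

definition add2 :: "array2 set \<Rightarrow> array2 \<Rightarrow> array2 \<Rightarrow> array2" where
  "add2 P = (THE f. is_addition2 P f)"

definition is_multiplication2 :: "array2 set \<Rightarrow> (array2 \<Rightarrow> array2 \<Rightarrow> array2) \<Rightarrow> bool" where
  "is_multiplication2 P g \<longleftrightarrow>
     g \<in> P \<rightarrow>\<^sub>E P \<rightarrow>\<^sub>E P \<and>
     (\<forall>A\<in>P. \<forall>i j. g A (one2 i j) = shift2 A i j) \<and>
     (\<forall>A\<in>P. \<forall>B\<in>P. \<forall>i j. g A (Sc i j B) = add2 P (g A B) (shift2 A i j))"

definition mult2 :: "array2 set \<Rightarrow> array2 \<Rightarrow> array2 \<Rightarrow> array2" where
  "mult2 P = (THE g. is_multiplication2 P g)"

definition nat2_semiring :: "array2 set \<Rightarrow> array2 ring" where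
  "nat2_semiring P =
     \<lparr>carrier = P, mult = mult2 P, one = one2 0 0, zero = \<zero>\<^sub>2, add = add2 P\<rparr>"

text \<open>The axioms are satisfiable, and the two definite descriptions denote.\<close>

inductive_set generated2 :: "array2 set" where
  "\<zero>\<^sub>2 \<in> generated2"
| "A \<in> generated2 \<Longrightarrow> Sc i j A \<in> generated2"

lemma Sc_not_zero2: "Sc i j A \<noteq> \<zero>\<^sub>2"
proof
  assume "Sc i j A = \<zero>\<^sub>2"
  then have "Sc i j A i j = \<zero>\<^sub>2 i j" by simp
  then show False by (simp add: Sc_def zero2_def)
qed

lemma Sc_index_inject:
  assumes "Sc i j A = Sc p q A" shows "i = p \<and> j = q"
proof -
  have "Sc i j A i j = Sc p q A i j" using assms by simp
  then show ?thesis by (simp add: Sc_def split: if_splits)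
qed

lemma Sc_array_inject:
  assumes "Sc i j A = Sc i j B" shows "A = B"
proof (intro ext)
  fix k l
  have "Sc i j A k l = Sc i j B k l" using assms by simp
  then show "A k l = B k l" by (simp add: Sc_def split: if_splits)
qed

lemma peano_2_system_generated2: "peano_2_system generated2"
proof
  fix S assume S: "S \<subseteq> generated2" "\<zero>\<^sub>2 \<in> S" "\<forall>A\<in>S. \<forall>i j. Sc i j A \<in> S"
  have "A \<in> S" if "A \<in> generated2" for A
    using that by induction (use S in auto)
  then show "S = generated2" using S by blast
qed (use Sc_not_zero2 Sc_index_inject Sc_array_inject in \<open>auto intro: generated2.intros\<close>)

definition convolution2 :: "array2 \<Rightarrow> array2 \<Rightarrow> array2" where
  "convolution2 A B = (\<lambda>k l. \<Sum>i\<le>k. \<Sum>j\<le>l. B i j * shift2 A i j k l)"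

context peano_2_system
begin

lemma P_induct [consumes 1, case_names zero Sc]:
  assumes "A \<in> P" "Q \<zero>\<^sub>2" "\<And>A i j. A \<in> P \<Longrightarrow> Q A \<Longrightarrow> Q (Sc i j A)"
  shows "Q A"
proof -
  have "{A \<in> P. Q A} = P"
    by (rule induction_axiom) (use assms zero_in Sc_in in auto)
  then show ?thesis using assms(1) by auto
qed

lemma one2_in: "one2 i j \<in> P"
  by (simp add: one2_def Sc_in zero_in)

lemma pointwise_in:
  assumes "A \<in> P" "B \<in> P" shows "(\<lambda>k l. A k l + B k l) \<in> P"
  using assms(2)
proof (induction rule: P_induct)
  case zero then show ?case using assms by (simp add: zero2_def)
next
  case (Sc B i j)
  have "(\<lambda>k l. A k l + Sc i j B k l) = Sc i j (\<lambda>k l. A k l + B k l)"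
    by (auto simp: Sc_def fun_eq_iff)
  then show ?case using Sc Sc_in by simp
qed

lemma shift2_in:
  assumes "A \<in> P" shows "shift2 A i j \<in> P"
  using assms
proof (induction rule: P_induct)
  case zero
  have "shift2 \<zero>\<^sub>2 i j = \<zero>\<^sub>2" by (auto simp: shift2_def zero2_def fun_eq_iff)
  then show ?case using zero_in by simp
next
  case (Sc A p q)
  have "shift2 (Sc p q A) i j = Sc (p + i) (q + j) (shift2 A i j)"
    by (auto simp: shift2_def Sc_def fun_eq_iff)
  then show ?case using Sc Sc_in by simp
qed

lemma is_addition2_pointwise:
  "is_addition2 P (\<lambda>A\<in>P. \<lambda>B\<in>P. \<lambda>k l. A k l + B k l)"
  unfolding is_addition2_def
  using pointwise_in Sc_in one2_in
  by (auto simp: Sc_def one2_def zero2_def fun_eq_iff)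

lemma is_addition2_zero:
  assumes "is_addition2 P f" "A \<in> P" shows "f A \<zero>\<^sub>2 = A"
proof -
  have "Sc 0 0 (f A \<zero>\<^sub>2) = f A (one2 0 0)"
    using assms zero_in by (simp add: is_addition2_def one2_def)
  also have "\<dots> = Sc 0 0 A" using assms by (simp add: is_addition2_def)
  finally show ?thesis by (rule Sc_array_inject)
qed

lemma addition2_unique: "\<exists>!f. is_addition2 P f"
proof (rule ex_ex1I)
  show "\<exists>f. is_addition2 P f" using is_addition2_pointwise by blast
next
  fix f g assume fg: "is_addition2 P f" "is_addition2 P g"
  have "f A B = g A B" if "A \<in> P" "B \<in> P" for A B
    using that(2)
  proof (induction rule: P_induct)
    case zero then show ?case using fg that(1) by (simp add: is_addition2_zero)
  next
    case (Sc B i j) then show ?case using fg that(1) by (simp add: is_addition2_def)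
  qed
  moreover have "f \<in> P \<rightarrow>\<^sub>E P \<rightarrow>\<^sub>E P" "g \<in> P \<rightarrow>\<^sub>E P \<rightarrow>\<^sub>E P"
    using fg by (simp_all add: is_addition2_def)
  ultimately show "f = g"
    by (intro PiE_ext[of f P _ g] PiE_ext[of "f _" P _ "g _"]) (auto simp: PiE_mem)
qed

lemma add2_eq: "add2 P = (\<lambda>A\<in>P. \<lambda>B\<in>P. \<lambda>k l. A k l + B k l)"
  unfolding add2_def
  using the1_equality[of "is_addition2 P", OF addition2_unique is_addition2_pointwise] .

lemma convolution2_zero: "convolution2 A \<zero>\<^sub>2 = \<zero>\<^sub>2"
  by (simp add: convolution2_def zero2_def)

lemma convolution2_Sc:
  "convolution2 A (Sc p q B) = (\<lambda>k l. convolution2 A B k l + shift2 A p q k l)"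
proof (intro ext)
  fix k l
  have "convolution2 A (Sc p q B) k l
      = (\<Sum>i\<le>k. \<Sum>j\<le>l. B i j * shift2 A i j k l
          + (if j = q then if i = p then shift2 A i j k l else 0 else 0))"
    unfolding convolution2_def by (intro sum.cong refl) (simp add: Sc_def)
  also have "\<dots> = convolution2 A B k l
      + (\<Sum>i\<le>k. if i = p then if q \<le> l then shift2 A p q k l else 0 else 0)"
    unfolding convolution2_def sum.distrib
    by (intro arg_cong2[where f = "(+)"] sum.cong refl) (simp add: sum.delta)
  also have "\<dots> = convolution2 A B k l + shift2 A p q k l"
    by (simp add: sum.delta shift2_def)
  finally show "convolution2 A (Sc p q B) k l = convolution2 A B k l + shift2 A p q k l" .
qed

lemma convolution2_in:
  assumes "A \<in> P" "B \<in> P" shows "convolution2 A B \<in> P"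
  using assms(2)
proof (induction rule: P_induct)
  case zero then show ?case using zero_in by (simp add: convolution2_zero)
next
  case (Sc B i j) then show ?case
    using pointwise_in shift2_in assms(1) by (simp add: convolution2_Sc)
qed

lemma is_multiplication2_convolution2:
  "is_multiplication2 P (\<lambda>A\<in>P. \<lambda>B\<in>P. convolution2 A B)"
proof -
  have "convolution2 A (one2 i j) = shift2 A i j" for A i j
    unfolding one2_def convolution2_Sc convolution2_zero by (simp add: zero2_def)
  then show ?thesis
    unfolding is_multiplication2_def
    using convolution2_in one2_in Sc_in shift2_in
    by (auto simp: add2_eq convolution2_Sc)
qed

lemma is_multiplication2_zero:
  assumes "is_multiplication2 P g" "A \<in> P" shows "g A \<zero>\<^sub>2 = \<zero>\<^sub>2"
proof -
  have "g A \<zero>\<^sub>2 \<in> P"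
    using assms zero_in by (auto simp: is_multiplication2_def PiE_mem)
  moreover have "add2 P (g A \<zero>\<^sub>2) (shift2 A 0 0) = shift2 A 0 0"
    using assms zero_in by (metis is_multiplication2_def one2_def)
  ultimately show ?thesis
    using shift2_in[OF assms(2)] by (simp add: add2_eq zero2_def fun_eq_iff)
qed

lemma multiplication2_unique: "\<exists>!g. is_multiplication2 P g"
proof (rule ex_ex1I)
  show "\<exists>g. is_multiplication2 P g" using is_multiplication2_convolution2 by blast
next
  fix f g assume fg: "is_multiplication2 P f" "is_multiplication2 P g"
  have "f A B = g A B" if "A \<in> P" "B \<in> P" for A B
    using that(2)
  proof (induction rule: P_induct)
    case zero then show ?case using fg that(1) by (simp add: is_multiplication2_zero)
  next
    case (Sc B i j) then show ?case using fg that(1) by (simp add: is_multiplication2_def)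
  qed
  moreover have "f \<in> P \<rightarrow>\<^sub>E P \<rightarrow>\<^sub>E P" "g \<in> P \<rightarrow>\<^sub>E P \<rightarrow>\<^sub>E P"
    using fg by (simp_all add: is_multiplication2_def)
  ultimately show "f = g"
    by (intro PiE_ext[of f P _ g] PiE_ext[of "f _" P _ "g _"]) (auto simp: PiE_mem)
qed

end

end

(*
  Over arrays, addition is pointwise and multiplication is convolution, that is, the multiplication
  of power series in two variables in which the shift by (i, j) is multiplication by the monomial
  1_ij. Convolution is linear in its right argument and commutes with shifts, so each remaining law
  follows by Peano induction on the right-most factor from its case for monomials.
*)
theory Submission
  imports Defs
begin

abbreviation plus2 :: "array2 \<Rightarrow> array2 \<Rightarrow> array2" where
  "plus2 A B \<equiv> (\<lambda>k l. A k l + B k l)"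

text \<open>Turns a Peano step into the addition of a monomial, so that linearity of convolution
  applies to it.\<close>

lemma Sc_eq_plus2: "Sc i j A = plus2 A (one2 i j)"
  by (auto simp: one2_def Sc_def zero2_def fun_eq_iff)

lemma shift2_plus2: "shift2 (plus2 A B) i j = plus2 (shift2 A i j) (shift2 B i j)"
  by (auto simp: shift2_def fun_eq_iff)

lemma shift2_zero2: "shift2 \<zero>\<^sub>2 i j = \<zero>\<^sub>2"
  by (auto simp: shift2_def zero2_def fun_eq_iff)

lemma shift2_0_0: "shift2 A 0 0 = A"
  by (simp add: shift2_def)

lemma shift2_Sc: "shift2 (Sc p q A) i j = Sc (p + i) (q + j) (shift2 A i j)"
  by (auto simp: shift2_def Sc_def fun_eq_iff)

lemma shift2_shift2: "shift2 (shift2 A p q) i j = shift2 A (p + i) (q + j)"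
  by (auto simp: shift2_def fun_eq_iff add.commute)

lemma shift2_one2: "shift2 (one2 p q) i j = one2 (p + i) (q + j)"
  by (simp add: one2_def shift2_Sc shift2_zero2)

lemma convolution2_plus2_right:
  "convolution2 A (plus2 B C) = plus2 (convolution2 A B) (convolution2 A C)"
  by (simp add: convolution2_def fun_eq_iff distrib_right sum.distrib)

text \<open>The left factor enters \<open>convolution2\<close> only through its shifts, and shifting
  is additive.\<close>

lemma convolution2_plus2_left:
  "convolution2 (plus2 A B) C = plus2 (convolution2 A C) (convolution2 B C)"
  by (simp add: convolution2_def shift2_plus2 fun_eq_iff distrib_left sum.distrib)

lemma convolution2_zero2_left: "convolution2 \<zero>\<^sub>2 A = \<zero>\<^sub>2"
  unfolding convolution2_def shift2_zero2 by (simp add: zero2_def)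

context peano_2_system
begin

lemma mult2_eq: "mult2 P = (\<lambda>A\<in>P. \<lambda>B\<in>P. convolution2 A B)"
  unfolding mult2_def
  using the1_equality[of "is_multiplication2 P", OF multiplication2_unique
    is_multiplication2_convolution2] .

lemma convolution2_one2_right: "convolution2 A (one2 i j) = shift2 A i j"
  unfolding one2_def convolution2_Sc convolution2_zero by (simp add: zero2_def)

text \<open>The monomial case of commutativity; at index (0, 0) it is the left unit law.\<close>

lemma convolution2_one2_left:
  assumes "A \<in> P" shows "convolution2 (one2 p q) A = shift2 A p q"
  using assms
proof (induction rule: P_induct)
  case zero
  then show ?case by (simp add: convolution2_zero shift2_zero2)
next
  case (Sc A i j)
  then show ?case
    \<comment> \<open>Both sides become \<open>shift2 A p q\<close> plus the monomial at the summed
      index. \<open>Sc_eq_plus2\<close> is restricted to that index, in either order of the sum,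
      leaving \<open>Sc i j A\<close> to \<open>convolution2_Sc\<close>.\<close>
    by (simp add: convolution2_Sc shift2_Sc shift2_one2 add.commute
        Sc_eq_plus2[of "i + p"] Sc_eq_plus2[of "p + i"])
qed

lemma convolution2_commute:
  assumes "A \<in> P" "B \<in> P" shows "convolution2 A B = convolution2 B A"
  using assms(2)
proof (induction rule: P_induct)
  case zero
  then show ?case by (simp add: convolution2_zero convolution2_zero2_left)
next
  case (Sc B i j)
  then show ?case
    using assms(1)
    by (simp add: convolution2_Sc Sc_eq_plus2 convolution2_plus2_left convolution2_plus2_right
        convolution2_one2_left convolution2_one2_right)
qed

text \<open>The monomial case of associativity: in the successor step both sides gain
  \<open>shift2 A (i + p) (j + q)\<close>.\<close>

lemma shift2_convolution2:
  assumes "B \<in> P" shows "shift2 (convolution2 A B) p q = convolution2 A (shift2 B p q)"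
  using assms
proof (induction rule: P_induct)
  case zero
  then show ?case by (simp add: convolution2_zero shift2_zero2)
next
  case (Sc B i j)
  then show ?case by (simp add: convolution2_Sc shift2_plus2 shift2_Sc shift2_shift2)
qed

lemma convolution2_assoc:
  assumes "B \<in> P" "C \<in> P"
  shows "convolution2 (convolution2 A B) C = convolution2 A (convolution2 B C)"
  using assms(2)
proof (induction rule: P_induct)
  case zero
  then show ?case by (simp add: convolution2_zero)
next
  case (Sc C i j)
  then show ?case
    \<comment> \<open>The new summands are \<open>shift2 (convolution2 A B) i j\<close> and
      \<open>convolution2 A (shift2 B i j)\<close>.\<close>
    using assms(1) by (simp add: convolution2_Sc convolution2_plus2_right shift2_convolution2)
qed

lemma comm_monoid_nat2_semiring: "comm_monoid (nat2_semiring P)"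
proof (rule comm_monoidI)
  fix A assume "A \<in> carrier (nat2_semiring P)"
  then show "\<one>\<^bsub>nat2_semiring P\<^esub> \<otimes>\<^bsub>nat2_semiring P\<^esub> A = A"
    by (simp add: nat2_semiring_def mult2_eq one2_in convolution2_one2_left shift2_0_0)
next
  fix A B assume "A \<in> carrier (nat2_semiring P)" "B \<in> carrier (nat2_semiring P)"
  then show "A \<otimes>\<^bsub>nat2_semiring P\<^esub> B = B \<otimes>\<^bsub>nat2_semiring P\<^esub> A"
    by (simp add: nat2_semiring_def mult2_eq convolution2_commute)
qed (simp_all add: nat2_semiring_def mult2_eq one2_in convolution2_in convolution2_assoc)

lemma abelian_monoid_nat2_semiring: "abelian_monoid (nat2_semiring P)"
  by (rule abelian_monoidI)
    \<comment> \<open>Only entries of \<open>zero2\<close> are unfolded; the array itself stays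
      folded for \<open>zero_in\<close>.\<close>
    (auto simp: nat2_semiring_def add2_eq zero_in pointwise_in zero2_def[THEN fun_cong, THEN fun_cong]
      ac_simps)

lemma semiring_nat2_semiring: "semiring (nat2_semiring P)"
proof -
  interpret abelian_monoid "nat2_semiring P" by (rule abelian_monoid_nat2_semiring)
  interpret comm_monoid "nat2_semiring P" by (rule comm_monoid_nat2_semiring)
  show ?thesis
    \<comment> \<open>With both monoids interpreted, distributivity and annihilation by zero
      remain.\<close>
    by unfold_locales
      (simp_all add: nat2_semiring_def add2_eq mult2_eq zero_in pointwise_in convolution2_in
        convolution2_plus2_left convolution2_plus2_right convolution2_zero convolution2_zero2_left)
qed

end

theorem mainTheorem1:
  fixes P :: "array2 set"
  assumes "peano_2_system P"
  shows "semiring (nat2_semiring P) \<and> comm_monoid (nat2_semiring P)"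
  using peano_2_system.semiring_nat2_semiring[OF assms]
    peano_2_system.comm_monoid_nat2_semiring[OF assms] by blast

end
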